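(* Let $q$ be a prime power, let $n\ge k\ge 1$ be integers, let $\mathcal{C}$ be an $[n,k,d]_q$ code, and let $c\in\mathcal{C}$ be a maximal codeword. Then $\omega(c)\ge (q-1)(k-1)+1$. In particular, if $\mathcal{C}$ is minimal, then $d\ge (q-1)(k-1)+1$.
   Context: For $v\in\mathbb{F}_q^n$, the support is $\sigma(v)=\{i : v_i\ne 0\}\subseteq\{1,\dots,n\}$ and the weight is $\omega(v)=|\sigma(v)|$. An $[n,k]_q$ code is an $\mathbb{F}_q$-linear subspace $\mathcal{C}\subseteq\mathbb{F}_q^n$ of dimension $k\ge1$; it is an $[n,k,d]_q$ code if $d$ is its minimum distance, $d=\min\{\omega(c): c\in\mathcal{C},\ c\neq 0\}$. A nonzero codeword $c\in\mathcal{C}$ is minimal if every $c'\in\mathcal{C}$ with $\sigma(c')\subseteq\sigma(c)$ is a scalar multiple of $c$; it is maximal if every $c'\in\mathcal{C}$ with $\sigma(c')\supseteq\sigma(c)$ is a scalar multiple of $c$. The code $\mathcal{C}$ is minimal if all its nonzero codewords are minimal. *)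

theory Defs
  imports "HOL-Analysis.Analysis"
begin

text \<open>
  The finite field is a type of class \<open>field\<close> and \<open>finite\<close>, with \<open>q\<close> its cardinality
  (hence a prime power), and the coordinates are indexed by a finite type of cardinality \<open>n\<close>.
  Subspaces and dimension are those of the vector space \<open>'a ^ 'n\<close> over the field \<open>'a\<close>
  (the \<open>vec\<close> interpretation), not over the reals.
\<close>

definition supp :: "'a::zero ^ 'n \<Rightarrow> 'n set" where
  "supp v = {i. v $ i \<noteq> 0}"

definition weight :: "'a::zero ^ 'n \<Rightarrow> nat" where
  "weight v = card (supp v)"

definition linear_code :: "nat \<Rightarrow> nat \<Rightarrow> nat \<Rightarrow> ('a::{field,finite} ^ 'n) set \<Rightarrow> bool" where
  "linear_code q n k C \<longleftrightarrow>
     CARD('a) = q \<and> CARD('n) = n \<and> vec.subspace C \<and> vec.dim C = k \<and> k \<ge> 1"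

text \<open>The minimum is over a nonempty set as soon as \<open>C\<close> has positive dimension.\<close>

definition min_distance :: "('a::{field,finite} ^ 'n) set \<Rightarrow> nat" where
  "min_distance C = Min {weight c | c. c \<in> C \<and> c \<noteq> 0}"

definition linear_code_dist ::
    "nat \<Rightarrow> nat \<Rightarrow> nat \<Rightarrow> nat \<Rightarrow> ('a::{field,finite} ^ 'n) set \<Rightarrow> bool" where
  "linear_code_dist q n k d C \<longleftrightarrow> linear_code q n k C \<and> min_distance C = d"

definition minimal_codeword :: "('a::{field,finite} ^ 'n) set \<Rightarrow> 'a ^ 'n \<Rightarrow> bool" where
  "minimal_codeword C c \<longleftrightarrow> c \<in> C \<and> c \<noteq> 0 \<and>
     (\<forall>c'\<in>C. supp c' \<subseteq> supp c \<longrightarrow> (\<exists>a. c' = a *s c))"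

definition maximal_codeword :: "('a::{field,finite} ^ 'n) set \<Rightarrow> 'a ^ 'n \<Rightarrow> bool" where
  "maximal_codeword C c \<longleftrightarrow> c \<in> C \<and> c \<noteq> 0 \<and>
     (\<forall>c'\<in>C. supp c \<subseteq> supp c' \<longrightarrow> (\<exists>a. c' = a *s c))"

definition minimal_code :: "('a::{field,finite} ^ 'n) set \<Rightarrow> bool" where
  "minimal_code C \<longleftrightarrow> (\<forall>c\<in>C. c \<noteq> 0 \<longrightarrow> minimal_codeword C c)"

end

theory Submission
  imports Defs "HOL-Computational_Algebra.Polynomial"
begin

text \<open>
  Fix a coordinate \<open>p\<close> in the support of a maximal codeword \<open>c\<close> and a complement \<open>H\<close> of the line
  through \<open>c\<close> in \<open>C\<close>. For \<open>v \<in> H\<close>, \<open>v \<noteq> 0\<close>, and any scalar \<open>a\<close>, the codeword \<open>v - a c\<close> is not a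
  multiple of \<open>c\<close>, so by maximality it vanishes at some coordinate in the support of \<open>c\<close>. Taking
  \<open>a = v\<^sub>p / c\<^sub>p + 1\<close>, this coordinate differs from \<open>p\<close>. Hence the product of the
  \<open>\<omega>(c) - 1\<close> affine functions \<open>v\<^sub>i / c\<^sub>i - v\<^sub>p / c\<^sub>p - 1\<close> vanishes on \<open>H\<close> exactly off the origin, and
  its sum over \<open>H\<close> is nonzero. On the other hand, the sum of a polynomial function over the
  \<open>(k-1)\<close>-dimensional space \<open>H\<close> is zero if its degree is less than \<open>(k-1)(q-1)\<close>. This is the
  Jamison / Brouwer-Schrijver bound for affine blocking sets.
\<close>

text \<open>For \<open>j > 0\<close>, the polynomial \<open>X^j - 1\<close> has at most
  \<open>j < q - 1\<close> roots, so some nonzero \<open>g\<close> has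
  \<open>g^j \<noteq> 1\<close>. Multiplication by \<open>g\<close> permutes the field and scales
  the sum by \<open>g^j\<close>, which forces it to vanish.\<close>

lemma sum_power_finite_field_eq_0:
  assumes "j < CARD('a::{field,finite}) - 1"
  shows "(\<Sum>t\<in>UNIV. t ^ j) = (0::'a)"
proof (cases "j = 0")
  case True
  \<comment> \<open>For \<open>j = 0\<close> every summand is 1, also at \<open>t = 0\<close>;
    translation by 1 shows that \<open>q\<close> is zero in the field.\<close>
  have "(\<Sum>t\<in>UNIV. t) = (\<Sum>t\<in>UNIV. t + 1 :: 'a)"
    by (rule sum.reindex_bij_witness[of _ "\<lambda>t. t + 1" "\<lambda>t. t - 1"]) auto
  also have "\<dots> = (\<Sum>t\<in>UNIV. t) + of_nat CARD('a)"
    by (simp add: sum.distrib)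
  finally show ?thesis using True by simp
next
  case False
  define p :: "'a poly" where "p = monom 1 j - 1"
  have deg: "degree p \<le> j"
    unfolding p_def by (rule degree_diff_le) (simp_all add: degree_monom_le)
  have "coeff p j = 1" using False by (simp add: p_def)
  then have "p \<noteq> 0" by auto
  then have "card {x. poly p x = 0} \<le> j"
    using card_poly_roots_bound deg le_trans by blast
  moreover have "card (UNIV - {0::'a}) = CARD('a) - 1" by (simp add: card_Diff_singleton)
  ultimately have "\<not> UNIV - {0} \<subseteq> {x. poly p x = 0}"
    using assms card_mono[of "{x. poly p x = 0}" "UNIV - {0}"] by fastforce
  then obtain g :: 'a where g: "g \<noteq> 0" "g ^ j \<noteq> 1"
    by (auto simp: p_def poly_monom)
  have "(\<Sum>t\<in>UNIV. t ^ j) = (\<Sum>t\<in>UNIV. (g * t) ^ j)"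
    by (rule sum.reindex_bij_witness[of _ "\<lambda>t. g * t" "\<lambda>t. t / g"]) (use g in auto)
  also have "\<dots> = g ^ j * (\<Sum>t\<in>UNIV. t ^ j)"
    by (simp add: power_mult_distrib sum_distrib_left)
  finally have "(1 - g ^ j) * (\<Sum>t\<in>UNIV. t ^ j) = 0" by (simp add: algebra_simps)
  then show ?thesis using g by simp
qed

text \<open>Uniqueness of the decomposition \<open>t *s b + v\<close> makes this a reindexing; it
  lets an induction peel off one basis vector.\<close>

lemma sum_span_insert:
  fixes b :: "'a::{field,finite} ^ 'n"
  assumes "b \<notin> vec.span B"
  shows "(\<Sum>v\<in>vec.span (insert b B). f v) = (\<Sum>t\<in>UNIV. \<Sum>v\<in>vec.span B. f (t *s b + v))"
proof -
  have "inj_on (\<lambda>(t, v). t *s b + v) (UNIV \<times> vec.span B)"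
  proof (rule inj_onI, clarsimp)
    fix s t u v
    assume u: "u \<in> vec.span B" and v: "v \<in> vec.span B" and eq: "s *s b + u = t *s b + v"
    have "(s - t) *s b = v - u"
      using eq by (simp add: vector_sub_rdistrib algebra_simps)
    then have "(s - t) *s b \<in> vec.span B"
      using u v by (simp add: vec.span_diff)
    then have "inverse (s - t) *s ((s - t) *s b) \<in> vec.span B"
      by (rule vec.span_scale)
    then have "s = t"
      using assms by (cases "s = t") (simp_all only: vector_smult_assoc, simp)
    then show "s = t \<and> u = v" using eq by simp
  qed
  moreover have "(\<lambda>(t, v). t *s b + v) ` (UNIV \<times> vec.span B) = vec.span (insert b B)"
  proof (intro set_eqI iffI)
    fix x assume "x \<in> vec.span (insert b B)"
    then obtain t where "x - t *s b \<in> vec.span B" by (auto simp: vec.span_insert)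
    then show "x \<in> (\<lambda>(t, v). t *s b + v) ` (UNIV \<times> vec.span B)"
      by (intro image_eqI[of _ _ "(t, x - t *s b)"]) auto
  next
    fix x assume "x \<in> (\<lambda>(t, v). t *s b + v) ` (UNIV \<times> vec.span B)"
    then obtain t v where "v \<in> vec.span B" "x = t *s b + v" by auto
    then show "x \<in> vec.span (insert b B)"
      by (auto simp: vec.span_insert intro!: exI[of _ t])
  qed
  ultimately have "bij_betw (\<lambda>(t, v). t *s b + v) (UNIV \<times> vec.span B) (vec.span (insert b B))"
    by (simp add: bij_betw_def)
  then show ?thesis
    by (simp add: sum.reindex_bij_betw[symmetric] sum.cartesian_product split_def)
qed

text \<open>Induction on the basis: expanding along \<open>b\<close> gives, for each
  \<open>J \<subseteq> I\<close>, a power sum of exponent \<open>card J\<close> times a sum of the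
  same kind over a smaller span. Below the degree bound, one of the two factors vanishes.\<close>

lemma sum_prod_affine_eq_0:
  fixes B :: "('a::{field,finite} ^ 'n) set" and l :: "'i \<Rightarrow> 'a ^ 'n \<Rightarrow> 'a"
  assumes "vec.independent B" and "finite I"
    and "\<And>i u v. l i (u + v) = l i u + l i v" and "\<And>i s v. l i (s *s v) = s * l i v"
    and "card I < card B * (CARD('a) - 1)"
  shows "(\<Sum>v\<in>vec.span B. \<Prod>i\<in>I. l i v + a i) = 0"
proof -
  have "finite B" by simp
  then show ?thesis using assms
  proof (induction B arbitrary: I rule: finite_induct)
    case empty
    then show ?case by simp
  next
    case (insert b B)
    have b: "b \<notin> vec.span B" and B: "vec.independent B"
      using insert.prems(1) insert.hyps by (auto simp: vec.independent_insert)
    have expand: "(\<Prod>i\<in>I. l i (t *s b + v) + a i) =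
        (\<Sum>J\<in>Pow I. t ^ card J * ((\<Prod>i\<in>J. l i b) * (\<Prod>i\<in>I - J. l i v + a i)))" for t v
    proof -
      have "(\<Prod>i\<in>I. l i (t *s b + v) + a i) = (\<Prod>i\<in>I. t * l i b + (l i v + a i))"
        using insert.prems(3,4) by (simp add: add.assoc)
      also have "\<dots> = (\<Sum>J\<in>Pow I. (\<Prod>i\<in>J. t * l i b) * (\<Prod>i\<in>I - J. l i v + a i))"
        using insert.prems(2) by (rule prod_add)
      finally show ?thesis by (simp add: prod.distrib mult.assoc)
    qed
    have "(\<Sum>v\<in>vec.span (insert b B). \<Prod>i\<in>I. l i v + a i) =
        (\<Sum>t\<in>UNIV. \<Sum>v\<in>vec.span B. \<Sum>J\<in>Pow I.
          t ^ card J * ((\<Prod>i\<in>J. l i b) * (\<Prod>i\<in>I - J. l i v + a i)))"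
      by (simp add: sum_span_insert[OF b] expand)
    also have "\<dots> = (\<Sum>t\<in>UNIV. \<Sum>J\<in>Pow I. \<Sum>v\<in>vec.span B.
          t ^ card J * ((\<Prod>i\<in>J. l i b) * (\<Prod>i\<in>I - J. l i v + a i)))"
      by (intro sum.cong refl, rule sum.swap)
    also have "\<dots> = (\<Sum>J\<in>Pow I. \<Sum>t\<in>UNIV. \<Sum>v\<in>vec.span B.
          t ^ card J * ((\<Prod>i\<in>J. l i b) * (\<Prod>i\<in>I - J. l i v + a i)))"
      by (rule sum.swap)
    also have "\<dots> = (\<Sum>J\<in>Pow I. (\<Sum>t\<in>UNIV. t ^ card J) *
          ((\<Prod>i\<in>J. l i b) * (\<Sum>v\<in>vec.span B. \<Prod>i\<in>I - J. l i v + a i)))"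
      by (simp only: sum_distrib_left[symmetric] sum_distrib_right[symmetric])
    also have "\<dots> = 0"
    proof (rule sum.neutral, rule ballI)
      fix J assume "J \<in> Pow I"
      then have J: "J \<subseteq> I" by simp
      show "(\<Sum>t\<in>UNIV. t ^ card J) *
          ((\<Prod>i\<in>J. l i b) * (\<Sum>v\<in>vec.span B. \<Prod>i\<in>I - J. l i v + a i)) = 0"
      proof (cases "card J < CARD('a) - 1")
        case True
        then show ?thesis by (simp add: sum_power_finite_field_eq_0)
      next
        case False
        \<comment> \<open>At least \<open>q - 1\<close> factors went into \<open>J\<close>, so few
          enough remain for the induction hypothesis at \<open>I - J\<close>.\<close>
        have "card (I - J) = card I - card J" "card J \<le> card I"
          using J insert.prems(2) by (auto simp: card_Diff_subset finite_subset card_mono)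
        then have "card (I - J) < card B * (CARD('a) - 1)"
          using False insert.prems(5) insert.hyps by simp
        then have "(\<Sum>v\<in>vec.span B. \<Prod>i\<in>I - J. l i v + a i) = 0"
          using insert.IH[OF B] insert.prems(2-4) by blast
        then show ?thesis by simp
      qed
    qed
    finally show ?case .
  qed
qed

lemma maximal_codeword_weight:
  fixes C :: "('a::{field,finite} ^ 'n) set"
  assumes "vec.subspace C" and "maximal_codeword C c"
  shows "(CARD('a) - 1) * (vec.dim C - 1) + 1 \<le> weight c"
proof -
  have c: "c \<in> C" "c \<noteq> 0"
    and max: "\<And>v. v \<in> C \<Longrightarrow> supp c \<subseteq> supp v \<Longrightarrow> \<exists>a. v = a *s c"
    using assms(2) by (auto simp: maximal_codeword_def)
  \<comment> \<open>The complement \<open>H\<close> is the span of \<open>B - {c}\<close>.\<close>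
  obtain B where B: "{c} \<subseteq> B" "B \<subseteq> C" "vec.independent B" "C \<subseteq> vec.span B"
    using vec.maximal_independent_subset_extend[of "{c}" C] c by auto
  have "card B = vec.dim C"
    using B vec.basis_card_eq_dim by blast
  then have card: "card (B - {c}) = vec.dim C - 1"
    using B by (simp add: card_Diff_singleton)
  have indep: "vec.independent (B - {c})"
    using B(3) by (rule vec.independent_mono) auto
  have "insert c (B - {c}) = B" using B by auto
  then have c_notin: "c \<notin> vec.span (B - {c})"
    using B(3) vec.independent_insert[of c "B - {c}"] by simp
  obtain p where p: "c $ p \<noteq> 0"
    using c by (auto simp: vec_eq_iff)
  define I where "I = supp c - {p}"
  define l where "l i v = v $ i / c $ i - v $ p / c $ p" for i and v :: "'a ^ 'n"
  have "(\<Prod>i\<in>I. l i v + (-1)) = 0" if v: "v \<in> vec.span (B - {c})" "v \<noteq> 0" for v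
  proof -
    define a where "a = v $ p / c $ p + 1"
    have "v \<in> C"
      using v B assms(1) vec.span_minimal[of "B - {c}" C] by blast
    then have "v - a *s c \<in> C"
      using c assms(1) by (simp add: vec.subspace_diff vec.subspace_scale)
    \<comment> \<open>Otherwise \<open>v\<close> would be a nonzero multiple of \<open>c\<close>,
      placing \<open>c\<close> itself in \<open>H\<close>.\<close>
    moreover have "v - a *s c \<noteq> s *s c" for s
    proof
      assume "v - a *s c = s *s c"
      then have eq: "v = (s + a) *s c"
        by (simp add: vector_sadd_rdistrib algebra_simps)
      then have "s + a \<noteq> 0" using v by (metis vec.scale_zero_left)
      then have "c = inverse (s + a) *s v" by (simp only: eq vector_smult_assoc) simp
      then show False using c_notin vec.span_scale[OF v(1)] by metis
    qed
    ultimately obtain i where i: "i \<in> supp c" "i \<notin> supp (v - a *s c)"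
      using max by blast
    then have "v $ i / c $ i = a" by (simp add: supp_def)
    then have "l i v + (-1) = 0" "i \<noteq> p"
      by (auto simp: l_def a_def)
    then show ?thesis using i by (auto simp: I_def intro: prod_zero)
  qed
  then have "(\<Sum>v\<in>vec.span (B - {c}). \<Prod>i\<in>I. l i v + (-1)) =
      (\<Sum>v\<in>{0}. \<Prod>i\<in>I. l i v + (-1))"
    by (intro sum.mono_neutral_right) (auto simp: vec.span_zero)
  \<comment> \<open>At the origin every factor is -1.\<close>
  also have "\<dots> \<noteq> 0" by (simp add: l_def)
  finally have "(\<Sum>v\<in>vec.span (B - {c}). \<Prod>i\<in>I. l i v + (-1)) \<noteq> 0" .
  moreover have "l i (u + v) = l i u + l i v" "l i (s *s v) = s * l i v" for i u v s
    by (simp_all add: l_def add_divide_distrib right_diff_distrib)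
  ultimately have "card (B - {c}) * (CARD('a) - 1) \<le> card I"
    using sum_prod_affine_eq_0[OF indep, of I l "\<lambda>_. -1"] by (force simp: not_less[symmetric])
  \<comment> \<open>The coordinate \<open>p\<close>, left out of \<open>I\<close>, accounts for the
    final \<open>+ 1\<close> in the bound.\<close>
  moreover have "weight c = card I + 1"
    using p card_Suc_Diff1[of "supp c" p] by (simp add: weight_def I_def supp_def)
  ultimately show ?thesis
    using card by (simp add: mult.commute)
qed

text \<open>Minimality is applied to the codeword with the larger support; the resulting scalar is
  nonzero and can be inverted.\<close>

lemma minimal_code_maximal_codeword:
  assumes "minimal_code C" and "c \<in> C" and "c \<noteq> 0"
  shows "maximal_codeword C c"
  unfolding maximal_codeword_def
proof (intro conjI ballI impI)
  fix v assume v: "v \<in> C" "supp c \<subseteq> supp v"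
  then have "v \<noteq> 0" using assms(3) by (auto simp: supp_def vec_eq_iff)
  then have "minimal_codeword C v"
    using assms(1) v by (auto simp: minimal_code_def)
  then obtain a where a: "c = a *s v"
    using assms(2) v by (auto simp: minimal_codeword_def)
  then have "a \<noteq> 0" using assms(3) by auto
  then have "v = inverse a *s c" by (simp add: a vector_smult_assoc)
  then show "\<exists>a. v = a *s c" ..
qed (use assms in auto)

lemma min_distance_attained:
  assumes "vec.dim C \<noteq> 0"
  obtains c where "c \<in> C" "c \<noteq> 0" "weight c = min_distance C"
proof -
  \<comment> \<open>A nonzero codeword makes the set of weights nonempty, so that \<open>Min\<close>
    is attained.\<close>
  have "\<not> C \<subseteq> {0}" using assms by (simp add: vec.dim_eq_0)
  then have "min_distance C \<in> {weight c | c. c \<in> C \<and> c \<noteq> 0}"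
    unfolding min_distance_def by (intro Min_in) auto
  then show thesis using that by auto
qed

theorem theorem2p8:
  fixes C :: "('a::{field,finite} ^ 'n) set" and q n k d :: nat
  assumes "1 \<le> k" and "k \<le> n"
    and "linear_code_dist q n k d C"
  shows "(\<forall>c. maximal_codeword C c \<longrightarrow> weight c \<ge> (q - 1) * (k - 1) + 1) \<and>
         (minimal_code C \<longrightarrow> d \<ge> (q - 1) * (k - 1) + 1)"
proof -
  have C: "CARD('a) = q" "vec.subspace C" "vec.dim C = k" "min_distance C = d"
    using assms(3) by (auto simp: linear_code_dist_def linear_code_def)
  have max: "(q - 1) * (k - 1) + 1 \<le> weight c" if "maximal_codeword C c" for c
    using maximal_codeword_weight[OF C(2) that] C by simp
  obtain c where "c \<in> C" "c \<noteq> 0" "weight c = d"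
    using min_distance_attained[of C] C assms(1) by auto
  then have "(q - 1) * (k - 1) + 1 \<le> d" if "minimal_code C"
    using max minimal_code_maximal_codeword[OF that] by blast
  then show ?thesis using max by blast
qed

end
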